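(* Let $n$ be a positive integer and $\{A_m\}_{m\ge0}$ a sequence. If $\{A_m\}$ is an even sequence and $n$ is odd, or if $\{A_m\}$ is an odd sequence and $n$ is even, then $$\sum_{\substack{k=0\\ 3\mid k}}^n\binom nkA_{n-k}=\sum_{\substack{k=0\\ 3\mid n-k}}^n\binom nkA_k=\frac13\sum_{k=0}^n\binom nkA_k.$$
   Context: A sequence $\{a_n\}_{n\ge0}$ of real (or complex) numbers is called an even sequence if $\sum_{k=0}^n\binom nk(-1)^ka_k=a_n$ for all $n=0,1,2,\ldots$, and an odd sequence if $\sum_{k=0}^n\binom nk(-1)^ka_k=-a_n$ for all $n=0,1,2,\ldots$. *)

theory Defs
  imports Complex_Main
begin

text \<open>
  Sequences take values in the class \<open>real_normed_field\<close>: by the Gelfand--Mazur theorem its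
  members are, up to isomorphism, exactly the real and the complex numbers.
\<close>

definition even_sequence :: "(nat \<Rightarrow> 'a::real_normed_field) \<Rightarrow> bool" where
  "even_sequence a \<longleftrightarrow> (\<forall>n. (\<Sum>k=0..n. of_nat (n choose k) * (- 1) ^ k * a k) = a n)"

definition odd_sequence :: "(nat \<Rightarrow> 'a::real_normed_field) \<Rightarrow> bool" where
  "odd_sequence a \<longleftrightarrow> (\<forall>n. (\<Sum>k=0..n. of_nat (n choose k) * (- 1) ^ k * a k) = - a n)"

end

theory Submission
  imports Defs
begin

text \<open>
  Let \<open>\<omega>\<close> be a primitive cube root of unity and \<open>e(j) = \<omega>^j + \<omega>^(2j)\<close>, i.e. \<open>e(j) = 2\<close> if
  \<open>3\<close> divides \<open>j\<close> and \<open>e(j) = -1\<close> otherwise. Since \<open>1 + \<omega> = -\<omega>^2\<close>, the binomial transform of \<open>e\<close>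
  is \<open>(-1)^n e(n)\<close>. Hence substituting the defining relation of an even or odd sequence into
  \<open>\<Sum> (n choose k) e(n-k) A(k)\<close> reproduces this sum with factor \<open>(-1)^n\<close>, respectively \<open>-(-1)^n\<close>.
  Under the parity hypothesis that factor is \<open>-1\<close>, so the sum vanishes, which is the claim.
\<close>

lemma sum_binomial_Suc:
  fixes f :: "nat \<Rightarrow> 'a::comm_ring_1"
  shows "(\<Sum>j\<le>Suc n. of_nat (Suc n choose j) * f j)
           = (\<Sum>j\<le>n. of_nat (n choose j) * (f j + f (Suc j)))"
proof -
  have "(\<Sum>j\<le>Suc n. of_nat (n choose j) * f j) = (\<Sum>j\<le>n. of_nat (n choose j) * f j)"
    by (simp add: binomial_eq_0)
  then have "f 0 + (\<Sum>j\<le>n. of_nat (n choose Suc j) * f (Suc j))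
      = (\<Sum>j\<le>n. of_nat (n choose j) * f j)"
    by (subst (asm) sum.atMost_Suc_shift) simp
  then show ?thesis
    by (subst sum.atMost_Suc_shift) (simp add: sum.distrib algebra_simps)
qed

text \<open>With \<open>E\<close> the shift operator, the recurrence says that 1 + E acts on
  \<open>e\<close> as -E^2. The left side is (1 + E)^n applied to \<open>e\<close> at 0, hence
  (-1)^n E^(2n).\<close>

lemma binomial_transform_cubic:
  fixes e :: "nat \<Rightarrow> 'a::comm_ring_1"
  assumes "\<And>j. e j + e (Suc j) + e (Suc (Suc j)) = 0"
  shows "(\<Sum>j\<le>n. of_nat (n choose j) * e j) = (- 1) ^ n * e (2 * n)"
  using assms
proof (induction n arbitrary: e)
  case 0
  then show ?case by simp
next
  case (Suc n)
  have "e j + e (Suc j) = - e (Suc (Suc j))" for j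
    using Suc.prems[of j] by (simp add: eq_neg_iff_add_eq_0)
  then have "(\<Sum>j\<le>Suc n. of_nat (Suc n choose j) * e j)
      = - (\<Sum>j\<le>n. of_nat (n choose j) * e (Suc (Suc j)))"
    unfolding sum_binomial_Suc by (simp add: sum_negf)
  also have "\<dots> = - ((- 1) ^ n * e (Suc (Suc (2 * n))))"
    using Suc.IH[of "\<lambda>j. e (Suc (Suc j))"] Suc.prems by simp
  finally show ?case by simp
qed

text \<open>Associativity of binomial convolution, applied to \<open>a\<close>, the constant
  sequence 1 and \<open>e\<close>.\<close>

lemma sum_binomial_product:
  fixes a e :: "nat \<Rightarrow> 'a::comm_ring_1"
  shows "(\<Sum>m\<le>n. of_nat (n choose m) * e (n - m) * (\<Sum>k\<le>m. of_nat (m choose k) * a k))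
           = (\<Sum>k\<le>n. of_nat (n choose k) * a k * (\<Sum>j\<le>n - k. of_nat (n - k choose j) * e j))"
proof -
  have "(\<Sum>m\<le>n. of_nat (n choose m) * e (n - m) * (\<Sum>k\<le>m. of_nat (m choose k) * a k))
      = (\<Sum>(m, k)\<in>(SIGMA m:{..n}. {..m}). of_nat ((n choose m) * (m choose k)) * e (n - m) * a k)"
    by (simp add: sum.Sigma[symmetric] sum_distrib_left mult_ac)
  also have "\<dots> = (\<Sum>(k, j)\<in>(SIGMA k:{..n}. {..n - k}).
      of_nat ((n choose k) * (n - k choose j)) * e j * a k)"
  \<comment> \<open>The new index is \<open>j = n - m\<close>. Both coefficients count pairs of
    nested subsets of sizes \<open>k\<close> and \<open>m\<close>; on the right one picks the
    \<open>k\<close>-set first, then the \<open>n - m\<close> elements outside the larger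
    set.\<close>
  proof (rule sum.reindex_bij_witness[where i = "\<lambda>(k, j). (n - j, k)" and j = "\<lambda>(m, k). (k, n - m)"],
      goal_cases)
    case (5 p)
    then obtain m k where p: "p = (m, k)" "k \<le> m" "m \<le> n" by auto
    have "(n choose m) * (m choose k) = (n choose k) * (n - k choose (m - k))"
      using p by (simp add: choose_mult)
    also have "(n - k choose (m - k)) = (n - k choose (n - m))"
      using p by (subst binomial_symmetric) auto
    finally show ?case using p by (simp del: of_nat_mult)
  qed auto
  also have "\<dots> = (\<Sum>k\<le>n. of_nat (n choose k) * a k * (\<Sum>j\<le>n - k. of_nat (n - k choose j) * e j))"
    by (simp add: sum.Sigma[symmetric] sum_distrib_left mult_ac)
  finally show ?thesis .
qed

theorem theorem3p1:
  fixes n :: nat and A :: "nat \<Rightarrow> 'a::real_normed_field"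
  assumes "n > 0"
    and "even_sequence A \<and> odd n \<or> odd_sequence A \<and> even n"
  shows "(\<Sum>k | k \<in> {0..n} \<and> 3 dvd k. of_nat (n choose k) * A (n - k))
           = (\<Sum>k | k \<in> {0..n} \<and> 3 dvd (n - k). of_nat (n choose k) * A k)
       \<and> (\<Sum>k | k \<in> {0..n} \<and> 3 dvd (n - k). of_nat (n choose k) * A k)
           = 1 / 3 * (\<Sum>k=0..n. of_nat (n choose k) * A k)"
proof
  show "(\<Sum>k | k \<in> {0..n} \<and> 3 dvd k. of_nat (n choose k) * A (n - k))
      = (\<Sum>k | k \<in> {0..n} \<and> 3 dvd (n - k). of_nat (n choose k) * A k)"
    by (rule sum.reindex_bij_witness[where i = "\<lambda>k. n - k" and j = "\<lambda>k. n - k"])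
      (auto simp: binomial_symmetric[symmetric])
  define e :: "nat \<Rightarrow> 'a" where "e j = (if 3 dvd j then 2 else - 1)" for j
  \<comment> \<open>By the parity hypothesis, \<open>s\<close> is 1 for an even sequence and -1 for
    an odd one, so both cases share the single relation \<open>A_eq\<close>.\<close>
  define s :: 'a where "s = - ((- 1) ^ n)"
  define W where "W = (\<Sum>k\<le>n. of_nat (n choose k) * e (n - k) * A k)"
  have A_eq: "A m = s * (\<Sum>k\<le>m. of_nat (m choose k) * ((- 1) ^ k * A k))" for m
    using assms(2) unfolding even_sequence_def odd_sequence_def s_def atLeast0AtMost
    by (auto simp: mult.assoc)
  have cubic: "e j + e (Suc j) + e (Suc (Suc j)) = 0" for j
  proof -
    consider "j mod 3 = 0" | "j mod 3 = 1" | "j mod 3 = 2" by linarith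
    then show ?thesis
      by cases (simp_all add: e_def dvd_eq_mod_eq_0 mod_Suc)
  qed
  \<comment> \<open>This turns the index \<open>2 * n\<close> produced by
    \<open>binomial_transform_cubic\<close> back into \<open>n\<close>.\<close>
  have e_double: "e (2 * j) = e j" for j
  proof -
    have "coprime (3 :: nat) 2" by (simp add: coprime_Suc_left_nat)
    then show ?thesis by (simp add: e_def coprime_dvd_mult_right_iff)
  qed
  have "W = s * (\<Sum>m\<le>n. of_nat (n choose m) * e (n - m)
      * (\<Sum>k\<le>m. of_nat (m choose k) * ((- 1) ^ k * A k)))"
    unfolding W_def sum_distrib_left[of s]
    by (rule sum.cong) (simp_all add: A_eq[symmetric] mult.left_commute[of s])
  also have "\<dots> = s * (\<Sum>k\<le>n. of_nat (n choose k) * ((- 1) ^ k * A k) * ((- 1) ^ (n - k) * e (n - k)))"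
    by (simp add: sum_binomial_product[where a = "\<lambda>k. (- 1) ^ k * A k"]
        binomial_transform_cubic[where e = e, OF cubic] e_double)
  \<comment> \<open>The signs from the relation for \<open>A\<close> and from the transform of
    \<open>e\<close> combine to (-1)^n for every \<open>k\<close>, so \<open>W\<close>
    reappears.\<close>
  also have "(\<Sum>k\<le>n. of_nat (n choose k) * ((- 1) ^ k * A k) * ((- 1) ^ (n - k) * e (n - k)))
      = (- 1) ^ n * W"
    unfolding W_def sum_distrib_left
  proof (rule sum.cong)
    fix k assume "k \<in> {..n}"
    then have "(- 1 :: 'a) ^ n = (- 1) ^ k * (- 1) ^ (n - k)"
      by (simp flip: power_add)
    then show "of_nat (n choose k) * ((- 1) ^ k * A k) * ((- 1) ^ (n - k) * e (n - k))
        = (- 1) ^ n * (of_nat (n choose k) * e (n - k) * A k)"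
      by (simp add: mult_ac)
  qed simp
  also have "s * ((- 1) ^ n * W) = - W"
    by (simp add: s_def flip: mult.assoc power_add mult_2)
  finally have "2 * W = 0"
    unfolding mult_2 by (metis add.right_inverse)
  then have "W = 0" by simp
  \<comment> \<open>\<open>e\<close> is three times the indicator of the multiples of 3, minus
    1.\<close>
  moreover have "W = 3 * (\<Sum>k | k \<in> {0..n} \<and> 3 dvd (n - k). of_nat (n choose k) * A k)
      - (\<Sum>k=0..n. of_nat (n choose k) * A k)"
  proof -
    have "W = (\<Sum>k=0..n. 3 * (if 3 dvd (n - k) then of_nat (n choose k) * A k else 0)
        - of_nat (n choose k) * A k)"
      unfolding W_def atLeast0AtMost by (rule sum.cong) (auto simp: e_def algebra_simps)
    then show ?thesis
      unfolding sum_subtractf sum_distrib_left[symmetric]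
      by (simp add: sum.inter_filter[symmetric])
  qed
  ultimately show "(\<Sum>k | k \<in> {0..n} \<and> 3 dvd (n - k). of_nat (n choose k) * A k)
      = 1 / 3 * (\<Sum>k=0..n. of_nat (n choose k) * A k)"
    by (simp add: mult.commute)
qed

end
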